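(* Let $k$ be a commutative ring with unit and let $(A,\star,\alpha)$ be a hom-associative $k$-algebra which is not strongly degenerate and whose twisting map $\alpha$ is surjective. Let $(A[[t]],\mu_t,\alpha_t)$ be a formal hom-associative deformation of $(A,\star,\alpha)$. Then $(A[[t]],\mu_t)$ is not strongly degenerate and $\alpha_t:A[[t]]\to A[[t]]$ is surjective.
   Context: A hom-associative $k$-algebra $(A,\star,\alpha)$ is a $k$-module $A$ with a $k$-bilinear operation $\star:A\times A\to A$ and a $k$-linear map $\alpha:A\to A$ (the twisting map) such that $\alpha(x)\star(y\star z)=(x\star y)\star\alpha(z)$ for all $x,y,z\in A$. Neither a unit nor multiplicativity of $\alpha$ is assumed. A set with binary operation $(B,\ast)$ is strongly degenerate if there exist $a\neq b$ in $B$ with $x\ast a=x\ast b$ and $a\ast x=b\ast x$ for all $x\in B$. $A[[t]]$ denotes the $k[[t]]$-module of formal power series $\sum_{i\ge 0}t^i a_i$ with $a_i\in A$. A formal (hom-associative) deformation of $(A,\star,\alpha)$ is a triple $(A[[t]],\mu_t,\alpha_t)$ where $\mu_t=\sum_{i\ge0}t^i\mu_i$ with $k$-bilinear maps $\mu_i:A\times A\to A$ and $\mu_0(a,b)=a\star b$, and $\alpha_t=\sum_{i\ge0}t^i\alpha_i$ with $k$-linear maps $\alpha_i:A\to A$ and $\alpha_0=\alpha$, both extended $k[[t]]$-(bi)linearly to power series in the usual way, i.e. $\mu_t(\sum_j t^ja_j,\sum_l t^lb_l)=\sum_{i,j,l}t^{i+j+l}\mu_i(a_j,b_l)$ and $\alpha_t(\sum_j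 t^ja_j)=\sum_{i,j}t^{i+j}\alpha_i(a_j)$, such that $(A[[t]],\mu_t,\alpha_t)$ is hom-associative, i.e. $\mu_t(\alpha_t(x),\mu_t(y,z))=\mu_t(\mu_t(x,y),\alpha_t(z))$ for all $x,y,z\in A[[t]]$. *)

theory Defs
  imports "HOL-Algebra.Module" "HOL-Library.FuncSet"
begin

(* The multiplication and unit fields that a module record inherits from the ring record
   are not used: bilinear operations on A are separate parameters, and carrier A is the
   underlying set of the algebra. The locale module includes that R is a commutative ring
   with unit (the zero ring is allowed). *)

definition linear_endo :: "('k, 'r) ring_scheme \<Rightarrow> ('k, 'a, 'm) module_scheme \<Rightarrow> ('a \<Rightarrow> 'a) \<Rightarrow> bool"
  where "linear_endo R A f \<longleftrightarrow>
    f \<in> carrier A \<rightarrow> carrier A \<and>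
    (\<forall>x \<in> carrier A. \<forall>y \<in> carrier A. f (x \<oplus>\<^bsub>A\<^esub> y) = f x \<oplus>\<^bsub>A\<^esub> f y) \<and>
    (\<forall>c \<in> carrier R. \<forall>x \<in> carrier A. f (c \<odot>\<^bsub>A\<^esub> x) = c \<odot>\<^bsub>A\<^esub> f x)"

definition bilinear_op ::
    "('k, 'r) ring_scheme \<Rightarrow> ('k, 'a, 'm) module_scheme \<Rightarrow> ('a \<Rightarrow> 'a \<Rightarrow> 'a) \<Rightarrow> bool"
  where "bilinear_op R A m \<longleftrightarrow>
    (\<forall>x \<in> carrier A. linear_endo R A (m x)) \<and>
    (\<forall>y \<in> carrier A. linear_endo R A (\<lambda>x. m x y))"

definition hom_associative :: "'b set \<Rightarrow> ('b \<Rightarrow> 'b \<Rightarrow> 'b) \<Rightarrow> ('b \<Rightarrow> 'b) \<Rightarrow> bool"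
  where "hom_associative B m \<alpha> \<longleftrightarrow>
    (\<forall>x \<in> B. \<forall>y \<in> B. \<forall>z \<in> B. m (\<alpha> x) (m y z) = m (m x y) (\<alpha> z))"

definition strongly_degenerate :: "'b set \<Rightarrow> ('b \<Rightarrow> 'b \<Rightarrow> 'b) \<Rightarrow> bool"
  where "strongly_degenerate B m \<longleftrightarrow>
    (\<exists>a \<in> B. \<exists>b \<in> B. a \<noteq> b \<and> (\<forall>x \<in> B. m x a = m x b \<and> m a x = m b x))"

locale hom_associative_algebra = module R A
  for R :: "('k, 'r) ring_scheme" (structure)
    and A :: "('k, 'a, 'm) module_scheme" (structure) +
  fixes star :: "'a \<Rightarrow> 'a \<Rightarrow> 'a"
    and \<alpha> :: "'a \<Rightarrow> 'a"
  assumes bilinear_star: "bilinear_op R A star"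
    and linear_twist: "linear_endo R A \<alpha>"
    and hom_assoc: "hom_associative (carrier A) star \<alpha>"

(* The power series with coefficients a i is represented by its coefficient
   function a, so that equality of series is equality of functions. *)

definition power_series :: "('k, 'a, 'm) module_scheme \<Rightarrow> (nat \<Rightarrow> 'a) set"
  where "power_series A = {a. \<forall>i. a i \<in> carrier A}"

(* The k[[t]]-(bi)linear extensions, given coefficientwise: the coefficient of t^n collects
   the finitely many terms of total degree n. *)

definition series_op ::
    "('k, 'a, 'm) module_scheme \<Rightarrow> (nat \<Rightarrow> 'a \<Rightarrow> 'a \<Rightarrow> 'a) \<Rightarrow> (nat \<Rightarrow> 'a) \<Rightarrow> (nat \<Rightarrow> 'a) \<Rightarrow> nat \<Rightarrow> 'a"
  where "series_op A \<mu> a b = (\<lambda>n.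
    finsum A (\<lambda>(i, j, l). \<mu> i (a j) (b l)) {(i, j, l). i + j + l = n})"

definition series_map ::
    "('k, 'a, 'm) module_scheme \<Rightarrow> (nat \<Rightarrow> 'a \<Rightarrow> 'a) \<Rightarrow> (nat \<Rightarrow> 'a) \<Rightarrow> nat \<Rightarrow> 'a"
  where "series_map A \<alpha>s a = (\<lambda>n.
    finsum A (\<lambda>(i, j). \<alpha>s i (a j)) {(i, j). i + j = n})"

locale formal_deformation = hom_associative_algebra R A star \<alpha>
  for R :: "('k, 'r) ring_scheme" (structure)
    and A :: "('k, 'a, 'm) module_scheme" (structure)
    and star :: "'a \<Rightarrow> 'a \<Rightarrow> 'a"
    and \<alpha> :: "'a \<Rightarrow> 'a" +
  fixes \<mu> :: "nat \<Rightarrow> 'a \<Rightarrow> 'a \<Rightarrow> 'a"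
    and \<alpha>s :: "nat \<Rightarrow> 'a \<Rightarrow> 'a"
  assumes bilinear_coeff: "\<And>i. bilinear_op R A (\<mu> i)"
    and linear_coeff: "\<And>i. linear_endo R A (\<alpha>s i)"
    and op_zero: "\<And>a b. a \<in> carrier A \<Longrightarrow> b \<in> carrier A \<Longrightarrow> \<mu> 0 a b = star a b"
    and twist_zero: "\<And>a. a \<in> carrier A \<Longrightarrow> \<alpha>s 0 a = \<alpha> a"
    and series_hom_assoc:
      "hom_associative (power_series A) (series_op A \<mu>) (series_map A \<alpha>s)"

end

theory Submission
  imports Defs
begin

text \<open>
  Both claims are triangularity statements: the coefficient of \<open>t ^ n\<close> in \<open>\<mu>\<^sub>t(x, a)\<close> involves
  the coefficient \<open>a n\<close> only through the single term \<open>\<mu>\<^sub>0 (x 0) (a n)\<close>, and likewise the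
  coefficient of \<open>t ^ n\<close> in \<open>\<alpha>\<^sub>t(a)\<close> involves \<open>a n\<close> only through \<open>\<alpha> (a n)\<close>.

  Hence, if \<open>a \<noteq> b\<close> were to witness strong degeneracy of the deformation, then at the first index
  \<open>n\<close> with \<open>a n \<noteq> b n\<close> all other terms would cancel, and \<open>a n\<close>, \<open>b n\<close> would witness strong
  degeneracy of the undeformed algebra (lemmas \<open>series_op_cancel_right\<close> and
  \<open>series_op_cancel_left\<close>). For surjectivity, the equation \<open>\<alpha>\<^sub>t(a) = c\<close> is solved one coefficient
  at a time: \<open>\<alpha> (a n)\<close> is prescribed by \<open>c n\<close> and the earlier coefficients of \<open>a\<close>, so
  surjectivity of \<open>\<alpha>\<close> supplies \<open>a n\<close> (lemmas \<open>series_map_split\<close> and \<open>series_map_surj\<close>).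
\<close>

lemma finite_triples_sum_eq: "finite {(i, j, l). i + j + l = (n::nat)}"
  by (rule finite_subset[of _ "{..n} \<times> {..n} \<times> {..n}"]) auto

context formal_deformation
begin

lemma mu_closed:
  assumes "x \<in> carrier A" "y \<in> carrier A"
  shows "\<mu> i x y \<in> carrier A"
  using bilinear_coeff[of i] assms unfolding bilinear_op_def linear_endo_def by blast

lemma alphas_closed:
  assumes "x \<in> carrier A"
  shows "\<alpha>s i x \<in> carrier A"
  using linear_coeff[of i] assms unfolding linear_endo_def by blast

text \<open>
  In a triple \<open>i + j + l = n\<close> other than \<open>(0, 0, n)\<close> the last entry is less than \<open>n\<close>, so all
  other terms of the coefficients agree and cancel.
\<close>

lemma series_op_cancel_right:
  assumes "x \<in> power_series A" "a \<in> power_series A" "b \<in> power_series A"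
    and agree: "\<And>l. l < n \<Longrightarrow> a l = b l"
    and eq: "series_op A \<mu> x a n = series_op A \<mu> x b n"
  shows "star (x 0) (a n) = star (x 0) (b n)"
proof -
  define S where "S = {(i, j, l). i + j + l = n} - {(0, 0, n)}"
  have fin: "finite S" unfolding S_def using finite_triples_sum_eq[of n] by simp
  have T: "{(i, j, l). i + j + l = n} = insert (0, 0, n) S" "(0, 0, n) \<notin> S"
    unfolding S_def by auto
  have cl: "x j \<in> carrier A" "a j \<in> carrier A" "b j \<in> carrier A" for j
    using assms(1-3) unfolding power_series_def by auto
  define r where "r = (\<lambda>c. finsum A (\<lambda>(i, j, l). \<mu> i (x j) (c l)) S)"
  have split: "series_op A \<mu> x c n = star (x 0) (c n) \<oplus>\<^bsub>A\<^esub> r c \<and> r c \<in> carrier A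
      \<and> star (x 0) (c n) \<in> carrier A"
    if c: "\<And>l. c l \<in> carrier A" for c
    unfolding series_op_def r_def T(1) using fin T(2)
    by (subst M.finsum_insert)
       (auto simp: mu_closed cl c op_zero[symmetric] intro!: M.finsum_closed)
  have "r a = r b"
    unfolding r_def by (rule M.finsum_cong') (auto simp: mu_closed cl S_def intro!: agree arg_cong[of _ _ "\<mu> _ _"])
  then show ?thesis using split[of a] split[of b] eq cl by (metis M.add.right_cancel)
qed

lemma series_op_cancel_left:
  assumes "x \<in> power_series A" "a \<in> power_series A" "b \<in> power_series A"
    and agree: "\<And>l. l < n \<Longrightarrow> a l = b l"
    and eq: "series_op A \<mu> a x n = series_op A \<mu> b x n"
  shows "star (a n) (x 0) = star (b n) (x 0)"
proof -
  define S where "S = {(i, j, l). i + j + l = n} - {(0, n, 0)}"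
  have fin: "finite S" unfolding S_def using finite_triples_sum_eq[of n] by simp
  have T: "{(i, j, l). i + j + l = n} = insert (0, n, 0) S" "(0, n, 0) \<notin> S"
    unfolding S_def by auto
  have cl: "x j \<in> carrier A" "a j \<in> carrier A" "b j \<in> carrier A" for j
    using assms(1-3) unfolding power_series_def by auto
  define r where "r = (\<lambda>c. finsum A (\<lambda>(i, j, l). \<mu> i (c j) (x l)) S)"
  have split: "series_op A \<mu> c x n = star (c n) (x 0) \<oplus>\<^bsub>A\<^esub> r c \<and> r c \<in> carrier A
      \<and> star (c n) (x 0) \<in> carrier A"
    if c: "\<And>l. c l \<in> carrier A" for c
    unfolding series_op_def r_def T(1) using fin T(2)
    by (subst M.finsum_insert)
       (auto simp: mu_closed cl c op_zero[symmetric] intro!: M.finsum_closed)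
  have "r a = r b"
    unfolding r_def
    by (rule M.finsum_cong')
       (auto simp: mu_closed cl S_def intro!: agree arg_cong[of _ _ "\<lambda>u. \<mu> _ u _"])
  then show ?thesis using split[of a] split[of b] eq cl by (metis M.add.right_cancel)
qed

lemma series_op_not_strongly_degenerate:
  assumes "\<not> strongly_degenerate (carrier A) star"
  shows "\<not> strongly_degenerate (power_series A) (series_op A \<mu>)"
proof
  assume "strongly_degenerate (power_series A) (series_op A \<mu>)"
  then obtain a b where ab: "a \<in> power_series A" "b \<in> power_series A" "a \<noteq> b"
    and deg: "\<And>x. x \<in> power_series A \<Longrightarrow>
      series_op A \<mu> x a = series_op A \<mu> x b \<and> series_op A \<mu> a x = series_op A \<mu> b x"
    unfolding strongly_degenerate_def by blast
  define n where "n = (LEAST i. a i \<noteq> b i)"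
  have ne: "a n \<noteq> b n" unfolding n_def by (rule LeastI_ex) (use ab(3) in auto)
  have agree: "a l = b l" if "l < n" for l using not_less_Least that unfolding n_def by blast
  have "star x (a n) = star x (b n) \<and> star (a n) x = star (b n) x" if x: "x \<in> carrier A" for x
  proof -
    \<comment> \<open>Any series with constant term \<open>x\<close> will do.\<close>
    have X: "(\<lambda>_. x) \<in> power_series A" using x unfolding power_series_def by simp
    show ?thesis
      using series_op_cancel_right[OF X ab(1,2) agree] series_op_cancel_left[OF X ab(1,2) agree]
        deg[OF X] by simp
  qed
  moreover have "a n \<in> carrier A" "b n \<in> carrier A" using ab unfolding power_series_def by auto
  ultimately show False using assms ne unfolding strongly_degenerate_def by blast
qed

lemma series_map_split:
  assumes a: "a \<in> power_series A"
  shows "series_map A \<alpha>s a n = \<alpha> (a n) \<oplus>\<^bsub>A\<^esub> (\<Oplus>\<^bsub>A\<^esub>j\<in>{..<n}. \<alpha>s (n - j) (a j))"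
proof -
  have cl: "a j \<in> carrier A" for j using a unfolding power_series_def by auto
  have "{(i, j). i + j = n} = (\<lambda>j. (n - j, j)) ` {..n}" by force
  then have "series_map A \<alpha>s a n = (\<Oplus>\<^bsub>A\<^esub>j\<in>{..n}. \<alpha>s (n - j) (a j))"
    unfolding series_map_def
    by (simp add: M.finsum_reindex inj_on_def alphas_closed cl image_subset_iff Pi_def)
  also have "{..n} = insert n {..<n}" by auto
  finally show ?thesis by (simp add: alphas_closed cl twist_zero[symmetric] Pi_def)
qed

lemma series_map_closed:
  assumes "a \<in> power_series A"
  shows "series_map A \<alpha>s a \<in> power_series A"
  using assms unfolding power_series_def series_map_def
  by (auto simp: alphas_closed intro!: M.finsum_closed)

lemma series_map_surj:
  assumes surj: "\<alpha> ` carrier A = carrier A"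
  shows "series_map A \<alpha>s ` power_series A = power_series A"
proof (intro equalityI subsetI)
  fix c assume c: "c \<in> power_series A"
  \<comment> \<open>The guard \<open>j < n\<close> makes the prescription for \<open>a n\<close> depend on the values of \<open>a\<close> below \<open>n\<close>
    even for functions \<open>a\<close> that leave the carrier, as well-founded choice requires.\<close>
  define s where "s = (\<lambda>a n. \<Oplus>\<^bsub>A\<^esub>j\<in>{..<n}. if j < n then \<alpha>s (n - j) (a j) else \<zero>\<^bsub>A\<^esub>)"
  have s_cong: "s a n = s b n" if "\<And>j. j < n \<Longrightarrow> a j = b j" for a b n
  proof -
    have "(\<lambda>j. if j < n then \<alpha>s (n - j) (a j) else \<zero>\<^bsub>A\<^esub>) =
      (\<lambda>j. if j < n then \<alpha>s (n - j) (b j) else \<zero>\<^bsub>A\<^esub>)" using that by auto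
    then show ?thesis unfolding s_def by simp
  qed
  have s_closed: "s a n \<in> carrier A" if "\<And>j. j < n \<Longrightarrow> a j \<in> carrier A" for a n
    unfolding s_def using that by (auto simp: alphas_closed intro!: M.finsum_closed)
  have c_closed: "c n \<in> carrier A" for n using c unfolding power_series_def by simp
  have "\<exists>a. \<forall>n. a n \<in> carrier A \<and> \<alpha> (a n) = c n \<ominus>\<^bsub>A\<^esub> s a n"
  proof (rule dependent_wellorder_choice)
    fix n :: nat and a assume "\<And>j. j < n \<Longrightarrow> a j \<in> carrier A \<and> \<alpha> (a j) = c j \<ominus>\<^bsub>A\<^esub> s a j"
    then have "c n \<ominus>\<^bsub>A\<^esub> s a n \<in> \<alpha> ` carrier A"
      using s_closed c_closed unfolding surj by simp
    then show "\<exists>r. r \<in> carrier A \<and> \<alpha> r = c n \<ominus>\<^bsub>A\<^esub> s a n" by fastforce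
  next
    fix r n and a b :: "nat \<Rightarrow> 'a"
    assume "\<And>j. j < n \<Longrightarrow> a j = b j"
    then show "(r \<in> carrier A \<and> \<alpha> r = c n \<ominus>\<^bsub>A\<^esub> s a n) = (r \<in> carrier A \<and> \<alpha> r = c n \<ominus>\<^bsub>A\<^esub> s b n)"
      using s_cong[of n a b] by simp
  qed
  then obtain a where a: "\<And>n. a n \<in> carrier A" "\<And>n. \<alpha> (a n) = c n \<ominus>\<^bsub>A\<^esub> s a n" by blast
  have A: "a \<in> power_series A" using a(1) unfolding power_series_def by simp
  have "series_map A \<alpha>s a n = c n" for n
  proof -
    have "(\<Oplus>\<^bsub>A\<^esub>j\<in>{..<n}. \<alpha>s (n - j) (a j)) = s a n"
      unfolding s_def by (rule M.finsum_cong') (auto simp: alphas_closed a(1))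
    then show ?thesis
      using s_closed[of n a] a c_closed[of n]
      by (simp add: series_map_split[OF A] a_minus_def M.a_assoc M.l_neg)
  qed
  then have "series_map A \<alpha>s a = c" by auto
  then show "c \<in> series_map A \<alpha>s ` power_series A" using A by blast
qed (use series_map_closed in blast)

end

theorem mainTheorem3:
  fixes R :: "('k, 'r) ring_scheme"
    and A :: "('k, 'a, 'm) module_scheme"
    and star :: "'a \<Rightarrow> 'a \<Rightarrow> 'a"
    and \<alpha> :: "'a \<Rightarrow> 'a"
    and \<mu> :: "nat \<Rightarrow> 'a \<Rightarrow> 'a \<Rightarrow> 'a"
    and \<alpha>s :: "nat \<Rightarrow> 'a \<Rightarrow> 'a"
  assumes "hom_associative_algebra R A star \<alpha>"
    and "\<not> strongly_degenerate (carrier A) star"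
    and "\<alpha> ` carrier A = carrier A"
    and "formal_deformation R A star \<alpha> \<mu> \<alpha>s"
  shows "\<not> strongly_degenerate (power_series A) (series_op A \<mu>) \<and>
    series_map A \<alpha>s ` power_series A = power_series A"
  using formal_deformation.series_op_not_strongly_degenerate[OF assms(4,2)]
    formal_deformation.series_map_surj[OF assms(4,3)] by blast

end
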